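(* Let $K$ be a field of characteristic zero and $n\geq 2$. Then the set of elements $\partial_1,\ x_2^2\partial_1,\ x_3^2\partial_1,\ldots,x_n^2\partial_1,\ x_1^2\partial_2,\ x_1^2\partial_3,\ldots,x_1^2\partial_n$ together with $H_1=x_1\partial_1$ is a minimal set of generators for the Lie algebra $\mathfrak{div}_n^c$.
   Context: $P_n=K[x_1,\ldots,x_n]$, $\partial_i=\partial/\partial x_i$, $D_n=\mathrm{Der}_K(P_n)=\bigoplus_{i=1}^n P_n\partial_i$ with bracket $[\partial,\delta]=\partial\delta-\delta\partial$. For $\partial=\sum_{i=1}^n a_i\partial_i\in D_n$, $\mathrm{div}(\partial)=\sum_{i=1}^n \partial a_i/\partial x_i$, and $\mathfrak{div}_n^c=\{\partial\in D_n : \mathrm{div}(\partial)\in K\}$, a Lie subalgebra of $D_n$. A set of generators of a $K$-Lie algebra is minimal if no proper subset of it generates the Lie algebra. *)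

theory Defs
  imports "HOL-Library.Poly_Mapping"
begin

section \<open>The polynomial ring in the variables with indices 1, ..., n\<close>

text \<open>Polynomials over \<open>'k\<close> in countably many variables: an exponent vector
  of type \<open>nat \<Rightarrow>\<^sub>0 nat\<close> is mapped to its coefficient. The ring of polynomials in
  the variables with indices \<open>1, \<dots>, n\<close> is a subset of this type.\<close>

type_synonym 'k mpol = "(nat \<Rightarrow>\<^sub>0 nat) \<Rightarrow>\<^sub>0 'k"

definition Const :: "'k::field \<Rightarrow> 'k mpol"
  where "Const c = Poly_Mapping.single 0 c"

definition X :: "nat \<Rightarrow> 'k::field mpol"
  where "X i = Poly_Mapping.single (Poly_Mapping.single i 1) 1"

definition poly_ring :: "nat \<Rightarrow> 'k::field mpol set"
  where "poly_ring n = {p. \<forall>m \<in> Poly_Mapping.keys p. Poly_Mapping.keys m \<subseteq> {1..n}}"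

text \<open>The subtraction of exponents is truncated, but if it truncates at \<open>i\<close> then
  the coefficient is zero.\<close>

definition pd :: "nat \<Rightarrow> 'k::field mpol \<Rightarrow> 'k mpol"
  where "pd i p = (\<Sum>m \<in> Poly_Mapping.keys p.
    Poly_Mapping.single (m - Poly_Mapping.single i 1)
      (of_nat (Poly_Mapping.lookup m i) * Poly_Mapping.lookup p m))"


section \<open>Derivations\<close>

text \<open>A map from \<open>poly_ring n\<close> to itself is represented by the function
  that extends it by \<open>0\<close> outside \<open>poly_ring n\<close>, so that equal maps are equal
  functions and the pointwise operations below are those of the maps.\<close>

definition Der :: "nat \<Rightarrow> ('k::field mpol \<Rightarrow> 'k mpol) set"
  where "Der n = {d.
    (\<forall>p \<in> poly_ring n. d p \<in> poly_ring n) \<and>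
    (\<forall>p. p \<notin> poly_ring n \<longrightarrow> d p = 0) \<and>
    (\<forall>p \<in> poly_ring n. \<forall>q \<in> poly_ring n. d (p + q) = d p + d q) \<and>
    (\<forall>c. \<forall>p \<in> poly_ring n. d (Const c * p) = Const c * d p) \<and>
    (\<forall>p \<in> poly_ring n. \<forall>q \<in> poly_ring n. d (p * q) = d p * q + p * d q)}"

definition partial :: "nat \<Rightarrow> nat \<Rightarrow> 'k::field mpol \<Rightarrow> 'k mpol"
  where "partial n i = (\<lambda>p. if p \<in> poly_ring n then pd i p else 0)"

definition pmult :: "'k::field mpol \<Rightarrow> ('k mpol \<Rightarrow> 'k mpol) \<Rightarrow> 'k mpol \<Rightarrow> 'k mpol"
    (infixr \<open>\<cdot>\<close> 75)
  where "a \<cdot> d = (\<lambda>p. a * d p)"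

definition bracket :: "('k::field mpol \<Rightarrow> 'k mpol) \<Rightarrow> ('k mpol \<Rightarrow> 'k mpol) \<Rightarrow> 'k mpol \<Rightarrow> 'k mpol"
  where "bracket d e = (\<lambda>p. d (e p) - e (d p))"

text \<open>The coefficient of \<open>d\<close> at the \<open>i\<close>-th partial derivative is \<open>d (X i)\<close>;
  see the lemmas \<open>Der_eq_sum_partial\<close>, \<open>sum_partial_in_Der\<close>, \<open>sum_partial_X\<close>
  and \<open>divergence_sum_partial\<close> below.\<close>

definition divergence :: "nat \<Rightarrow> ('k::field mpol \<Rightarrow> 'k mpol) \<Rightarrow> 'k mpol"
  where "divergence n d = (\<Sum>i = 1..n. pd i (d (X i)))"

definition div_const :: "nat \<Rightarrow> ('k::field mpol \<Rightarrow> 'k mpol) set"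
  where "div_const n = {d \<in> Der n. divergence n d \<in> range Const}"


section \<open>Generators of Lie algebras of derivations\<close>

definition lie_subalgebra :: "nat \<Rightarrow> ('k::field mpol \<Rightarrow> 'k mpol) set \<Rightarrow> bool"
  where "lie_subalgebra n L \<longleftrightarrow>
    L \<subseteq> Der n \<and>
    (\<lambda>_. 0) \<in> L \<and>
    (\<forall>d \<in> L. \<forall>e \<in> L. (\<lambda>p. d p + e p) \<in> L) \<and>
    (\<forall>c. \<forall>d \<in> L. Const c \<cdot> d \<in> L) \<and>
    (\<forall>d \<in> L. \<forall>e \<in> L. bracket d e \<in> L)"

definition lie_generated :: "nat \<Rightarrow> ('k::field mpol \<Rightarrow> 'k mpol) set \<Rightarrow> ('k mpol \<Rightarrow> 'k mpol) set"
  where "lie_generated n S = \<Inter> {L. lie_subalgebra n L \<and> S \<subseteq> L}"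

definition minimal_generating_set ::
    "nat \<Rightarrow> ('k::field mpol \<Rightarrow> 'k mpol) set \<Rightarrow> ('k mpol \<Rightarrow> 'k mpol) set \<Rightarrow> bool"
  where "minimal_generating_set n L S \<longleftrightarrow>
    S \<subseteq> L \<and> lie_generated n S = L \<and> (\<forall>T. T \<subset> S \<longrightarrow> lie_generated n T \<noteq> L)"


section \<open>Basic facts\<close>

lemma mpol_induct [case_names zero add]:
  fixes p :: "'a \<Rightarrow>\<^sub>0 'b::comm_monoid_add"
  assumes "P 0"
    and "\<And>m c q. c \<noteq> 0 \<Longrightarrow> m \<notin> Poly_Mapping.keys q \<Longrightarrow> P q \<Longrightarrow> P (Poly_Mapping.single m c + q)"
  shows "P p"
proof (induction p rule: update_induct)
  case const
  then show ?case using assms(1) by simp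
next
  case (update f a b)
  have "Poly_Mapping.update a b f = Poly_Mapping.single a b + f"
    using update
    by (intro poly_mapping_eqI)
      (auto simp: lookup_update lookup_add lookup_single when_def in_keys_iff)
  then show ?case using update assms(2) by simp
qed

lemma poly_ring_induct [consumes 1, case_names zero add]:
  assumes "p \<in> poly_ring n" "P 0"
    and "\<And>m c q. Poly_Mapping.keys m \<subseteq> {1..n} \<Longrightarrow> q \<in> poly_ring n \<Longrightarrow> P q
      \<Longrightarrow> P (Poly_Mapping.single m c + q)"
  shows "P p"
  using assms(1)
proof (induction p rule: mpol_induct)
  case zero
  then show ?case using assms(2) by simp
next
  case (add m c q)
  have "Poly_Mapping.keys (Poly_Mapping.single m c + q) = insert m (Poly_Mapping.keys q)"
    using add(1,2) by (auto simp: in_keys_iff lookup_add lookup_single when_def split: if_splits)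
  with add show ?case using assms(3) by (auto simp: poly_ring_def)
qed

lemma poly_ring_zero [simp]: "0 \<in> poly_ring n"
  by (simp add: poly_ring_def)

lemma poly_ring_Const [simp]: "Const c \<in> poly_ring n"
  by (simp add: poly_ring_def Const_def)

lemma poly_ring_X [simp]: "i \<in> {1..n} \<Longrightarrow> X i \<in> poly_ring n"
  by (simp add: poly_ring_def X_def)

lemma poly_ring_single:
  "Poly_Mapping.keys m \<subseteq> {1..n} \<Longrightarrow> Poly_Mapping.single m c \<in> poly_ring n"
  by (simp add: poly_ring_def)

lemma poly_ring_add: "p \<in> poly_ring n \<Longrightarrow> q \<in> poly_ring n \<Longrightarrow> p + q \<in> poly_ring n"
  using keys_add[of p q] by (fastforce simp: poly_ring_def)

lemma poly_ring_diff:
  assumes "p \<in> poly_ring n" "q \<in> poly_ring n"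
  shows "p - q \<in> poly_ring n"
proof -
  have "Poly_Mapping.keys (p - q) \<subseteq> Poly_Mapping.keys p \<union> Poly_Mapping.keys q"
    by (auto simp: in_keys_iff lookup_minus)
  then show ?thesis using assms unfolding poly_ring_def by blast
qed

lemma poly_ring_mult: "p \<in> poly_ring n \<Longrightarrow> q \<in> poly_ring n \<Longrightarrow> p * q \<in> poly_ring n"
proof -
  assume p: "p \<in> poly_ring n" and q: "q \<in> poly_ring n"
  show ?thesis unfolding poly_ring_def
  proof safe
    fix m i assume m: "m \<in> Poly_Mapping.keys (p * q)" and i: "i \<in> Poly_Mapping.keys m"
    obtain a b where ab: "m = a + b" "a \<in> Poly_Mapping.keys p" "b \<in> Poly_Mapping.keys q"
      using m keys_mult[of p q] by blast
    have "i \<in> Poly_Mapping.keys a \<or> i \<in> Poly_Mapping.keys b"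
      using i keys_add[of a b] ab(1) by blast
    then show "i \<in> {1..n}"
      using p q ab(2,3) unfolding poly_ring_def by blast
  qed
qed

lemma poly_ring_sum: "(\<And>i. i \<in> A \<Longrightarrow> f i \<in> poly_ring n) \<Longrightarrow> sum f A \<in> poly_ring n"
  by (induction A rule: infinite_finite_induct) (auto intro: poly_ring_add)

lemma pd_zero [simp]: "pd i 0 = 0"
  by (simp add: pd_def)

lemma pd_superset:
  assumes "finite A" "Poly_Mapping.keys p \<subseteq> A"
  shows "pd i p = (\<Sum>m \<in> A. Poly_Mapping.single (m - Poly_Mapping.single i 1)
      (of_nat (Poly_Mapping.lookup m i) * Poly_Mapping.lookup p m))"
  unfolding pd_def
  by (rule sum.mono_neutral_left) (use assms in \<open>auto simp: in_keys_iff\<close>)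

lemma pd_add: "pd i (p + q) = pd i p + pd i q"
proof -
  let ?A = "Poly_Mapping.keys p \<union> Poly_Mapping.keys q"
  have "pd i (p + q) = (\<Sum>m \<in> ?A. Poly_Mapping.single (m - Poly_Mapping.single i 1)
      (of_nat (Poly_Mapping.lookup m i) * Poly_Mapping.lookup (p + q) m))"
    by (rule pd_superset) (use keys_add[of p q] in auto)
  then show ?thesis
    by (simp add: pd_superset[of ?A p] pd_superset[of ?A q] lookup_add ring_distribs
        single_add sum.distrib)
qed

lemma pd_single: "pd i (Poly_Mapping.single m c) =
    Poly_Mapping.single (m - Poly_Mapping.single i 1) (of_nat (Poly_Mapping.lookup m i) * c)"
  by (cases "c = 0") (auto simp: pd_def)

lemma pd_Const [simp]: "pd i (Const c) = 0"
  by (simp add: Const_def pd_single)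

lemma pd_X: "pd i (X j) = (if i = j then 1 else 0)"
  by (auto simp: X_def pd_single lookup_single)

lemma pd_mult_single:
  "pd i (Poly_Mapping.single a c * Poly_Mapping.single b d) =
     pd i (Poly_Mapping.single a c) * Poly_Mapping.single b d +
     Poly_Mapping.single a c * pd i (Poly_Mapping.single b (d :: 'k::field))"
proof -
  let ?e = "Poly_Mapping.single i (1::nat)"
  have sub: "x - ?e + y = x + y - ?e" if "Poly_Mapping.lookup x i \<noteq> 0" for x y
    by (rule poly_mapping_eqI) (use that in \<open>auto simp: lookup_add lookup_minus lookup_single when_def\<close>)
  have 1: "Poly_Mapping.single (a - ?e + b) (of_nat (Poly_Mapping.lookup a i) * c * d) =
    Poly_Mapping.single (a + b - ?e) (of_nat (Poly_Mapping.lookup a i) * c * d)"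
    by (cases "Poly_Mapping.lookup a i = 0") (simp_all add: sub del: One_nat_def)
  have 2: "Poly_Mapping.single (a + (b - ?e)) (of_nat (Poly_Mapping.lookup b i) * c * d) =
    Poly_Mapping.single (a + b - ?e) (of_nat (Poly_Mapping.lookup b i) * c * d)"
    using sub[of b a] by (cases "Poly_Mapping.lookup b i = 0") (simp_all add: add.commute del: One_nat_def)
  show ?thesis
    using 1 2 by (simp add: pd_single mult_single lookup_add algebra_simps single_add del: One_nat_def)
qed

lemma pd_mult: "pd i (p * q) = pd i p * q + p * pd i q"
proof (induction p rule: mpol_induct)
  case (add m c p)
  have "pd i (Poly_Mapping.single m c * q) =
      pd i (Poly_Mapping.single m c) * q + Poly_Mapping.single m c * pd i q"
  proof (induction q rule: mpol_induct)
    case (add m' c' q)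
    then show ?case
      by (simp add: ring_distribs pd_add pd_mult_single)
  qed simp
  with add show ?case by (simp add: ring_distribs pd_add)
qed simp

lemma pd_in_poly_ring: "p \<in> poly_ring n \<Longrightarrow> pd i p \<in> poly_ring n"
  unfolding pd_def
proof (rule poly_ring_sum, rule poly_ring_single)
  fix m assume "p \<in> poly_ring n" "m \<in> Poly_Mapping.keys p"
  then show "Poly_Mapping.keys (m - Poly_Mapping.single i 1) \<subseteq> {1..n}"
    by (force simp: poly_ring_def in_keys_iff lookup_minus subset_iff)
qed

lemma partial_in_Der: "partial n i \<in> Der n"
  by (auto simp: Der_def partial_def pd_add pd_mult pd_in_poly_ring poly_ring_add poly_ring_mult)

lemma DerI:
  assumes "\<And>p. p \<in> poly_ring n \<Longrightarrow> d p \<in> poly_ring n"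
    and "\<And>p. p \<notin> poly_ring n \<Longrightarrow> d p = 0"
    and "\<And>p q. p \<in> poly_ring n \<Longrightarrow> q \<in> poly_ring n \<Longrightarrow> d (p + q) = d p + d q"
    and "\<And>c p. p \<in> poly_ring n \<Longrightarrow> d (Const c * p) = Const c * d p"
    and "\<And>p q. p \<in> poly_ring n \<Longrightarrow> q \<in> poly_ring n \<Longrightarrow> d (p * q) = d p * q + p * d q"
  shows "d \<in> Der n"
  unfolding Der_def using assms by blast

context
  fixes n and d :: "'k::field mpol \<Rightarrow> 'k mpol"
  assumes d: "d \<in> Der n"
begin

lemma Der_closed: "p \<in> poly_ring n \<Longrightarrow> d p \<in> poly_ring n"
  using d unfolding Der_def by blast

lemma Der_outside: "p \<notin> poly_ring n \<Longrightarrow> d p = 0"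
  using d unfolding Der_def by blast

lemma Der_plus: "p \<in> poly_ring n \<Longrightarrow> q \<in> poly_ring n \<Longrightarrow> d (p + q) = d p + d q"
  using d unfolding Der_def by blast

lemma Der_scale: "p \<in> poly_ring n \<Longrightarrow> d (Const c * p) = Const c * d p"
  using d unfolding Der_def by blast

lemma Der_mult: "p \<in> poly_ring n \<Longrightarrow> q \<in> poly_ring n \<Longrightarrow> d (p * q) = d p * q + p * d q"
  using d unfolding Der_def by blast

lemma Der_apply_zero: "d 0 = 0"
  using Der_plus[of 0 0] by (metis add_cancel_left_left add_0_left poly_ring_zero)

end

lemma Der_zero: "(\<lambda>_. 0) \<in> Der n"
  by (rule DerI) simp_all

lemma Der_add:
  assumes "d \<in> Der n" "e \<in> Der n"
  shows "(\<lambda>p. d p + e p) \<in> Der n"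
proof (rule DerI, goal_cases)
  case (5 p q)
  then show ?case by (simp add: assms[THEN Der_mult] algebra_simps)
qed (simp_all add: assms[THEN Der_closed] assms[THEN Der_outside] assms[THEN Der_plus]
  assms[THEN Der_scale] poly_ring_add distrib_left add_ac)

lemma Der_pmult:
  assumes a: "a \<in> poly_ring n" and d: "d \<in> Der n"
  shows "a \<cdot> d \<in> Der n"
  unfolding pmult_def
proof (rule DerI, goal_cases)
  case (5 p q)
  then show ?case by (simp add: Der_mult[OF d] algebra_simps)
qed (simp_all add: a Der_closed[OF d] Der_outside[OF d] Der_plus[OF d] Der_scale[OF d]
  poly_ring_mult distrib_left mult.left_commute)

lemma Der_bracket:
  assumes d: "d \<in> Der n" and e: "e \<in> Der n"
  shows "bracket d e \<in> Der n"
  unfolding bracket_def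
proof (rule DerI, goal_cases)
  case (5 p q)
  then show ?case
    using Der_closed[OF d] Der_closed[OF e]
    by (simp add: Der_mult[OF d] Der_mult[OF e] Der_plus[OF d] Der_plus[OF e] poly_ring_mult
        algebra_simps)
qed (simp_all add: Der_closed[OF d] Der_closed[OF e] Der_outside[OF d] Der_outside[OF e]
  Der_apply_zero[OF d] Der_apply_zero[OF e] Der_plus[OF d] Der_plus[OF e]
  Der_scale[OF d] Der_scale[OF e] poly_ring_diff right_diff_distrib)

lemma lie_subalgebra_Der: "lie_subalgebra n (Der n)"
  by (auto simp: lie_subalgebra_def intro: Der_zero Der_add Der_pmult Der_bracket)

lemma Der_sum: "(\<And>i. i \<in> A \<Longrightarrow> f i \<in> Der n) \<Longrightarrow> (\<lambda>p. \<Sum>i \<in> A. f i p) \<in> Der n"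
  by (induction A rule: infinite_finite_induct) (auto intro: Der_zero Der_add)

lemma sum_partial_in_Der:
  "(\<And>i. i \<in> {1..n} \<Longrightarrow> a i \<in> poly_ring n) \<Longrightarrow> (\<lambda>p. \<Sum>i = 1..n. (a i \<cdot> partial n i) p) \<in> Der n"
  by (intro Der_sum Der_pmult partial_in_Der)

lemma sum_partial_X:
  assumes "j \<in> {1..n}"
  shows "(\<Sum>i = 1..n. (a i \<cdot> partial n i) (X j)) = a j"
proof -
  have "(\<Sum>i = 1..n. (a i \<cdot> partial n i) (X j)) = (\<Sum>i = 1..n. if i = j then a i else 0)"
    using assms by (intro sum.cong refl) (simp add: pmult_def partial_def pd_X)
  then show ?thesis using assms by simp
qed

lemma divergence_sum_partial:
  "divergence n (\<lambda>p. \<Sum>i = 1..n. (a i \<cdot> partial n i) p) = (\<Sum>i = 1..n. pd i (a i))"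
  unfolding divergence_def by (intro sum.cong refl) (simp only: sum_partial_X)

lemma Der_eqI:
  assumes d: "d \<in> Der n" and e: "e \<in> Der n" and X: "\<And>i. i \<in> {1..n} \<Longrightarrow> d (X i) = e (X i)"
  shows "d = e"
proof
  fix p
  have one: "f 1 = 0" if "f \<in> Der n" for f :: "'a mpol \<Rightarrow> 'a mpol"
  proof -
    have "1 \<in> poly_ring n" using poly_ring_Const[of 1 n] by (simp add: Const_def)
    then have "f (1 * 1) = f 1 * 1 + 1 * f 1" by (intro Der_mult[OF that])
    then show ?thesis unfolding mult_1_left mult_1_right by (metis add_cancel_left_left)
  qed
  have const: "f (Const c) = 0" if "f \<in> Der n" for f :: "'a mpol \<Rightarrow> 'a mpol" and c
  proof -
    have "1 \<in> poly_ring n" using poly_ring_Const[of 1 n] by (simp add: Const_def)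
    then have "f (Const c * 1) = Const c * f 1" by (rule Der_scale[OF that])
    then show ?thesis using one[OF that] by simp
  qed
  have pow: "d (Poly_Mapping.single (Poly_Mapping.single i k) 1) =
      e (Poly_Mapping.single (Poly_Mapping.single i k) 1)" if i: "i \<in> {1..n}" for i k
  proof (induction k)
    case 0
    then show ?case using one[OF d] one[OF e] by simp
  next
    case (Suc k)
    let ?m = "Poly_Mapping.single (Poly_Mapping.single i k) (1::'a)"
    have eq: "Poly_Mapping.single (Poly_Mapping.single i (Suc k)) (1::'a) = X i * ?m"
      by (simp add: X_def mult_single flip: single_add)
    have "?m \<in> poly_ring n" by (rule poly_ring_single) (use i in auto)
    then show ?case unfolding eq
      using Suc X[OF i] Der_mult[OF d poly_ring_X[OF i]] Der_mult[OF e poly_ring_X[OF i]] by simp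
  qed
  have mono: "d (Poly_Mapping.single m 1) = e (Poly_Mapping.single m 1)"
    if "Poly_Mapping.keys m \<subseteq> {1..n}" for m
    using that
  proof (induction m rule: mpol_induct)
    case zero
    then show ?case using one[OF d] one[OF e] by simp
  next
    case (add i k m)
    have "Poly_Mapping.keys (Poly_Mapping.single i k + m) = insert i (Poly_Mapping.keys m)"
      using add(1,2) by (auto simp: in_keys_iff lookup_add lookup_single when_def split: if_splits)
    then have i: "i \<in> {1..n}" and m: "Poly_Mapping.keys m \<subseteq> {1..n}" using add.prems by auto
    let ?p = "Poly_Mapping.single (Poly_Mapping.single i k) (1::'a)"
    let ?q = "Poly_Mapping.single m (1::'a)"
    have eq: "Poly_Mapping.single (Poly_Mapping.single i k + m) (1::'a) = ?p * ?q"
      by (simp add: mult_single)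
    have "?p \<in> poly_ring n" "?q \<in> poly_ring n"
      by (rule poly_ring_single; use i m in auto)+
    then show ?case unfolding eq using Der_mult[OF d] Der_mult[OF e] pow[OF i] add.IH[OF m] by simp
  qed
  show "d p = e p"
  proof (cases "p \<in> poly_ring n")
    case True
    then show ?thesis
    proof (induction p rule: poly_ring_induct)
      case zero
      then show ?case using Der_apply_zero[OF d] Der_apply_zero[OF e] by simp
    next
      case (add m c q)
      have eq: "Poly_Mapping.single m c = Const c * Poly_Mapping.single m 1"
        by (simp add: Const_def mult_single)
      have p: "Poly_Mapping.single m (1::'a) \<in> poly_ring n" "Poly_Mapping.single m c \<in> poly_ring n"
        by (rule poly_ring_single, rule add(1))+
      have "d (Poly_Mapping.single m c) = e (Poly_Mapping.single m c)"
        unfolding eq using Der_mult[OF d poly_ring_Const p(1)] Der_mult[OF e poly_ring_Const p(1)]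
          const[OF d] const[OF e] mono[OF add(1)] by simp
      then show ?case using add.IH Der_plus[OF d p(2) add(2)] Der_plus[OF e p(2) add(2)] by simp
    qed
  next
    case False
    then show ?thesis using d e by (simp add: Der_def)
  qed
qed

lemma Der_eq_sum_partial:
  assumes "d \<in> Der n"
  shows "d = (\<lambda>p. \<Sum>i = 1..n. (d (X i) \<cdot> partial n i) p)"
proof (rule Der_eqI[OF assms])
  show "(\<lambda>p. \<Sum>i = 1..n. (d (X i) \<cdot> partial n i) p) \<in> Der n"
    using assms poly_ring_X by (intro sum_partial_in_Der) (auto simp: Der_def)
qed (simp only: sum_partial_X)

end

(* Write H_f = (d_i f) d_1 - (d_1 f) d_i for fixed i >= 2. Then [H_f, H_g] = H_h where h is the
   Poisson bracket of f and g in the variables x_1 and x_i, all other variables being constants.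
   From x_i, x_i^3 and x_1^3 one gets all monomials x_1^a x_i^b by Poisson brackets, as brackets
   with x_1^2 x_i and x_1 x_i^2 raise the exponents. If z does not involve x_1 and x_i, then
   z d_1 = H_{x_i z}, and its bracket with H_{x_1^(a+1) x_i^b} yields H_{x_1^a x_i^b z}; in
   particular x_i^k z d_1 is reached from z d_1, so by induction on the variables all z d_1 with z
   free of x_1, and hence all H_f, are generated. Integrating the coefficients at d_2, ..., d_n with
   respect to x_1 writes a derivation of constant divergence as a sum of fields H_f, a field g d_1
   with g free of x_1 and a multiple of x_1 d_1.
   Each generator s is separated from the others by a Lie subalgebra: the fields of divergence 0
   for s = x_1 d_1, and otherwise the stabilizer of a subspace of polynomials, namely those without
   constant term (s = d_1), those free of x_i (s = x_i^2 d_1), or K x_i (s = x_1^2 d_i). *)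

theory Submission
  imports Defs
begin

section \<open>Constants and partial derivatives\<close>

lemma Const_zero [simp]: "Const 0 = 0"
  by (simp add: Const_def)

lemma Const_eq_zero_iff [simp]: "Const c = 0 \<longleftrightarrow> c = 0"
  unfolding Const_def by (metis lookup_single_eq lookup_zero single_zero)

lemma Const_one [simp]: "Const 1 = 1"
  by (simp add: Const_def)

lemma Const_add: "Const (a + b) = Const a + Const b"
  by (simp add: Const_def single_add)

lemma Const_minus: "Const (- a) = - Const a"
  by (simp add: Const_def single_uminus)

lemma Const_mult: "Const (a * b) = Const a * Const b"
  by (simp add: Const_def mult_single)

lemma Const_of_nat: "Const (of_nat k) = of_nat k"
  by (induction k) (simp_all add: Const_add)

lemma Const_of_int: "Const (of_int k) = of_int k"
  by (cases k) (simp_all add: Const_of_nat Const_minus Const_add del: of_nat_Suc)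

lemma lookup_Const_mult: "Poly_Mapping.lookup (Const c * p) m = c * Poly_Mapping.lookup p m"
proof (induction p rule: mpol_induct)
  case (add k d q)
  then show ?case
    by (simp add: distrib_left lookup_add Const_def mult_single lookup_single when_def)
qed simp

lemma pd_Const_mult: "pd i (Const c * p) = Const c * pd i p"
  by (simp add: pd_mult)

lemma pd_uminus: "pd i (- p) = - pd i p"
  using pd_add[of i p "- p"] by (simp add: eq_neg_iff_add_eq_0 add.commute)

lemma pd_diff: "pd i (p - q) = pd i p - pd i q"
  using pd_add[of i p "- q"] by (simp add: pd_uminus)

lemma pd_sum: "pd i (sum f A) = (\<Sum>j \<in> A. pd i (f j))"
  by (induction A rule: infinite_finite_induct) (simp_all add: pd_add)

lemma pd_one [simp]: "pd i 1 = 0"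
  using pd_Const[of i 1] by simp

lemma pd_power: "pd i (p ^ k) = of_nat k * p ^ (k - 1) * pd i p"
proof (induction k)
  case (Suc k)
  then show ?case
    by (cases k) (simp_all add: pd_mult algebra_simps)
qed simp

lemma pd_commute: "pd i (pd j p) = pd j (pd i p)"
proof (induction p rule: mpol_induct)
  case (add m c q)
  have "m - Poly_Mapping.single j 1 - Poly_Mapping.single i 1 =
      m - Poly_Mapping.single i 1 - Poly_Mapping.single j (1::nat)"
    by (rule poly_mapping_eqI) (simp add: lookup_minus)
  then have "pd i (pd j (Poly_Mapping.single m c)) = pd j (pd i (Poly_Mapping.single m c))"
    by (cases "i = j")
      (simp_all add: pd_single lookup_minus lookup_single when_def ac_simps del: One_nat_def)
  with add show ?case by (simp add: pd_add)
qed simp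

lemma pd_single_eq_zero: "Poly_Mapping.lookup m i = 0 \<Longrightarrow> pd i (Poly_Mapping.single m c) = 0"
  by (simp add: pd_single)

lemma lookup_pd:
  "Poly_Mapping.lookup (pd i p) m =
    of_nat (Suc (Poly_Mapping.lookup m i)) * Poly_Mapping.lookup p (m + Poly_Mapping.single i 1)"
proof (induction p rule: mpol_induct)
  case (add k c q)
  \<comment> \<open>Truncated subtraction can be undone only at a positive exponent; at exponent 0
    the factor \<open>of_nat 0\<close> removes the term anyway.\<close>
  have "k - Poly_Mapping.single i 1 = m \<longleftrightarrow> k = m + Poly_Mapping.single i 1"
    if "Poly_Mapping.lookup k i \<noteq> 0"
  proof
    assume "k - Poly_Mapping.single i 1 = m"
    then show "k = m + Poly_Mapping.single i 1"
      using that
      by (intro poly_mapping_eqI) (auto simp: lookup_add lookup_minus lookup_single when_def)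
  qed simp
  with add show ?case
    by (cases "Poly_Mapping.lookup k i = 0")
      (auto simp: pd_add pd_single lookup_add lookup_single when_def algebra_simps
        simp del: One_nat_def)
qed simp

text \<open>In characteristic zero, a monomial of \<open>p\<close> containing \<open>X i\<close>
  leaves a nonzero multiple of its coefficient in \<open>pd i p\<close>. So the kernel of
  \<open>pd i\<close> consists of the polynomials free of \<open>X i\<close>.\<close>

lemma pd_eq_zeroD:
  fixes p :: "'k::field_char_0 mpol"
  assumes "pd i p = 0" "m \<in> Poly_Mapping.keys p"
  shows "Poly_Mapping.lookup m i = 0"
proof (rule ccontr)
  assume m: "Poly_Mapping.lookup m i \<noteq> 0"
  then have "m = (m - Poly_Mapping.single i 1) + Poly_Mapping.single i 1"
    by (intro poly_mapping_eqI) (auto simp: lookup_add lookup_minus lookup_single when_def)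
  then have "Poly_Mapping.lookup (pd i p) (m - Poly_Mapping.single i 1) =
      of_nat (Suc (Poly_Mapping.lookup (m - Poly_Mapping.single i 1) i)) * Poly_Mapping.lookup p m"
    by (metis lookup_pd)
  with assms show False
    by (simp add: in_keys_iff del: of_nat_Suc)
qed

text \<open>Integration term by term; the division by the raised exponent is possible in
  characteristic zero.\<close>

lemma pd_antiderivative:
  fixes p :: "'k::field_char_0 mpol"
  assumes "p \<in> poly_ring n" "i \<in> {1..n}"
  shows "\<exists>f \<in> poly_ring n. pd i f = p"
  using assms(1)
proof (induction p rule: poly_ring_induct)
  case zero
  show ?case by (rule bexI[of _ 0]) simp_all
next
  case (add m c q)
  then obtain f where f: "f \<in> poly_ring n" "pd i f = q" by blast
  let ?s = "Poly_Mapping.single (m + Poly_Mapping.single i 1)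
    (c / of_nat (Suc (Poly_Mapping.lookup m i)))"
  have "?s \<in> poly_ring n"
    using add(1) assms(2) keys_add[of m "Poly_Mapping.single i 1"]
    by (intro poly_ring_single) (fastforce split: if_splits)
  moreover have "pd i ?s = Poly_Mapping.single m c"
    by (simp add: pd_single lookup_add del: of_nat_Suc)
  ultimately show ?case
    using f by (intro bexI[of _ "?s + f"]) (simp_all add: pd_add poly_ring_add)
qed

lemma poly_ring_one [simp]: "1 \<in> poly_ring n"
  using poly_ring_Const[of 1 n] by simp

lemma poly_ring_power: "p \<in> poly_ring n \<Longrightarrow> p ^ k \<in> poly_ring n"
  by (induction k) (simp_all add: poly_ring_mult)

lemma X_power: "X i ^ k = Poly_Mapping.single (Poly_Mapping.single i k) 1"
proof (induction k)
  case (Suc k)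
  then show ?case by (simp add: X_def mult_single flip: single_add)
qed simp

lemma Der_apply:
  assumes "d \<in> Der n" "p \<in> poly_ring n"
  shows "d p = (\<Sum>i = 1..n. d (X i) * pd i p)"
  using fun_cong[OF Der_eq_sum_partial[OF assms(1)], of p] assms(2)
  by (simp add: pmult_def partial_def)

lemma Der_apply_Const: "d \<in> Der n \<Longrightarrow> d (Const c) = 0"
  using Der_apply[of d n "Const c"] by simp

section \<open>Lie subalgebras defined by the divergence and by stabilizers\<close>

lemma divergence_zero: "divergence n (\<lambda>_. 0) = 0"
  by (simp add: divergence_def)

lemma divergence_add: "divergence n (\<lambda>p. d p + e p) = divergence n d + divergence n e"
  by (simp add: divergence_def pd_add sum.distrib)

lemma divergence_scale: "divergence n (Const c \<cdot> d) = Const c * divergence n d"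
  by (simp add: divergence_def pmult_def pd_Const_mult sum_distrib_left)

lemma divergence_pmult_partial:
  assumes "i \<in> {1..n}"
  shows "divergence n (a \<cdot> partial n i) = pd i a"
proof -
  have "divergence n (a \<cdot> partial n i) = (\<Sum>j = 1..n. if i = j then pd i a else 0)"
    unfolding divergence_def
    by (intro sum.cong refl) (simp add: pmult_def partial_def pd_X)
  then show ?thesis using assms by simp
qed

text \<open>Expanding by the product rule, the second-order terms give the right-hand side. The
  first-order terms form the trace of a product of two Jacobian matrices, which does not depend on
  their order and so cancels.\<close>

lemma divergence_bracket:
  assumes d: "d \<in> Der n" and e: "e \<in> Der n"
  shows "divergence n (bracket d e) = d (divergence n e) - e (divergence n d)"
proof -
  have *: "(\<Sum>i = 1..n. pd i (a (b (X i)))) =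
      (\<Sum>i = 1..n. \<Sum>j = 1..n. pd i (a (X j)) * pd j (b (X i))) + a (divergence n b)"
    if a: "a \<in> Der n" and b: "b \<in> Der n" for a b
  proof -
    have "(\<Sum>i = 1..n. pd i (a (b (X i)))) =
        (\<Sum>i = 1..n. pd i (\<Sum>j = 1..n. a (X j) * pd j (b (X i))))"
      by (intro sum.cong refl arg_cong[of _ _ "pd _"] Der_apply[OF a] Der_closed[OF b])
        simp
    also have "\<dots> = (\<Sum>i = 1..n. \<Sum>j = 1..n. pd i (a (X j)) * pd j (b (X i))) +
        (\<Sum>i = 1..n. \<Sum>j = 1..n. a (X j) * pd i (pd j (b (X i))))"
      by (simp add: pd_sum pd_mult sum.distrib)
    also have "(\<Sum>i = 1..n. \<Sum>j = 1..n. a (X j) * pd i (pd j (b (X i)))) =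
        (\<Sum>j = 1..n. a (X j) * pd j (divergence n b))"
      by (subst sum.swap) (simp add: divergence_def pd_sum sum_distrib_left pd_commute)
    also have "\<dots> = a (divergence n b)"
      unfolding divergence_def
      by (subst (2) Der_apply[OF a])
        (auto intro!: poly_ring_sum pd_in_poly_ring Der_closed[OF b])
    finally show ?thesis .
  qed
  have "divergence n (bracket d e) =
      (\<Sum>i = 1..n. pd i (d (e (X i)))) - (\<Sum>i = 1..n. pd i (e (d (X i))))"
    by (simp add: divergence_def bracket_def pd_diff sum_subtractf)
  moreover have "(\<Sum>i = 1..n. \<Sum>j = 1..n. pd i (d (X j)) * pd j (e (X i))) =
      (\<Sum>i = 1..n. \<Sum>j = 1..n. pd i (e (X j)) * pd j (d (X i)))"
    by (subst sum.swap) (simp add: mult.commute)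
  ultimately show ?thesis
    by (simp add: *[OF d e] *[OF e d] del: One_nat_def)
qed

text \<open>Derivations kill constants, so a bracket of two such fields has divergence 0. Used with
  \<open>V = range Const\<close> for \<open>div_const n\<close> and with \<open>V = {0}\<close> to
  split off \<open>X 1 \<cdot> partial n 1\<close>.\<close>

lemma lie_subalgebra_divergence:
  assumes "V \<subseteq> range Const" "0 \<in> V"
    and "\<And>u v. u \<in> V \<Longrightarrow> v \<in> V \<Longrightarrow> u + v \<in> V"
    and "\<And>c v. v \<in> V \<Longrightarrow> Const c * v \<in> V"
  shows "lie_subalgebra n {d \<in> Der n. divergence n d \<in> V}"
proof -
  have "divergence n (bracket d e) = 0"
    if *: "d \<in> Der n" "e \<in> Der n" "divergence n d \<in> V" "divergence n e \<in> V" for d e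
  proof -
    obtain a b where "divergence n d = Const a" "divergence n e = Const b"
      using subsetD[OF assms(1) *(3)] subsetD[OF assms(1) *(4)] by blast
    with *(1,2) show ?thesis by (simp add: divergence_bracket Der_apply_Const)
  qed
  then show ?thesis
    by (simp add: lie_subalgebra_def divergence_zero divergence_add divergence_scale assms(2-4)
        Der_zero Der_add Der_pmult Der_bracket)
qed

lemma lie_subalgebra_div_const: "lie_subalgebra n (div_const n)"
  unfolding div_const_def
proof (rule lie_subalgebra_divergence)
  show "0 \<in> range Const"
    by (rule range_eqI[of _ _ 0]) simp
  show "u + v \<in> range Const" if "u \<in> range Const" "v \<in> range Const" for u v :: "'a mpol"
    using that by (auto simp flip: Const_add)
  show "Const c * v \<in> range Const" if "v \<in> range Const" for c and v :: "'a mpol"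
    using that by (auto simp flip: Const_mult)
qed simp

lemma lie_subalgebra_stabilizer:
  assumes "V \<subseteq> poly_ring n" "0 \<in> V"
    and add: "\<And>u v. u \<in> V \<Longrightarrow> v \<in> V \<Longrightarrow> u + v \<in> V"
    and scale: "\<And>c v. v \<in> V \<Longrightarrow> Const c * v \<in> V"
  shows "lie_subalgebra n {d \<in> Der n. d ` V \<subseteq> V}"
proof -
  have diff: "u - v \<in> V" if "u \<in> V" "v \<in> V" for u v
    using add[OF that(1) scale[OF that(2), of "- 1"]] by (simp add: Const_minus)
  have "(Const c \<cdot> d) ` V \<subseteq> V" if "d ` V \<subseteq> V" for c d
    using that scale by (simp add: pmult_def image_subset_iff)
  moreover have "bracket d e ` V \<subseteq> V" if "d ` V \<subseteq> V" "e ` V \<subseteq> V" for d e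
    using that diff by (simp add: bracket_def image_subset_iff)
  moreover have "(\<lambda>p. d p + e p) ` V \<subseteq> V" if "d ` V \<subseteq> V" "e ` V \<subseteq> V" for d e
    using that add by (simp add: image_subset_iff)
  ultimately show ?thesis
    using assms(2) by (simp add: lie_subalgebra_def Der_zero Der_add Der_pmult Der_bracket image_subset_iff)
qed

lemma lie_generated_subset: "lie_subalgebra n L \<Longrightarrow> S \<subseteq> L \<Longrightarrow> lie_generated n S \<subseteq> L"
  unfolding lie_generated_def by blast

section \<open>Hamiltonian derivations\<close>

text \<open>The field \<open>H_f\<close> in the variables \<open>X j\<close> and \<open>X i\<close>.
  Its value at \<open>g\<close> is the Poisson bracket \<open>{f, g}\<close>, so
  \<open>ham n j i f g\<close> also serves as notation for that bracket.\<close>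

definition ham :: "nat \<Rightarrow> nat \<Rightarrow> nat \<Rightarrow> 'k::field mpol \<Rightarrow> 'k mpol \<Rightarrow> 'k mpol"
  where "ham n j i f = (\<lambda>p. (pd i f \<cdot> partial n j) p + (- pd j f \<cdot> partial n i) p)"

lemma ham_in_Der: "f \<in> poly_ring n \<Longrightarrow> ham n j i f \<in> Der n"
  unfolding ham_def
  by (intro Der_add Der_pmult partial_in_Der pd_in_poly_ring)
    (simp_all add: pd_in_poly_ring poly_ring_diff[of 0, simplified] flip: pd_uminus)

lemma ham_apply: "p \<in> poly_ring n \<Longrightarrow> ham n j i f p = pd i f * pd j p - pd j f * pd i p"
  by (simp add: ham_def pmult_def partial_def)

lemma ham_add: "ham n j i (f + g) = (\<lambda>p. ham n j i f p + ham n j i g p)"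
  by (simp add: ham_def pmult_def pd_add algebra_simps)

lemma ham_scale: "ham n j i (Const c * f) = Const c \<cdot> ham n j i f"
  by (simp add: ham_def pmult_def pd_Const_mult right_diff_distrib mult.assoc)

lemma ham_zero: "ham n j i 0 = (\<lambda>_. 0)"
  by (simp add: ham_def pmult_def)

lemma ham_eq_pmult_partial: "pd j f = 0 \<Longrightarrow> ham n j i f = pd i f \<cdot> partial n j"
  by (simp add: ham_def pmult_def)

lemma ham_eq_pmult_partial': "pd i f = 0 \<Longrightarrow> ham n j i f = - pd j f \<cdot> partial n i"
  by (simp add: ham_def pmult_def)

text \<open>This is the Jacobi identity of the Poisson bracket, checked on the variables only, as
  these determine a derivation.\<close>

lemma bracket_ham:
  assumes f: "f \<in> poly_ring n" and g: "g \<in> poly_ring n"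
  shows "bracket (ham n j i f) (ham n j i g) = ham n j i (ham n j i f g)"
proof (rule Der_eqI)
  show "bracket (ham n j i f) (ham n j i g) \<in> Der n"
    by (intro Der_bracket ham_in_Der f g)
  have h: "ham n j i f g \<in> poly_ring n"
    by (intro Der_closed[OF ham_in_Der] f g)
  then show "ham n j i (ham n j i f g) \<in> Der n"
    by (rule ham_in_Der)
  fix k assume k: "k \<in> {1..n}"
  then have *: "ham n j i h (X k) \<in> poly_ring n" if "h \<in> poly_ring n" for h :: "'a mpol"
    by (intro Der_closed[OF ham_in_Der] that poly_ring_X)
  have pdc: "pd j (pd i p) = pd i (pd j p)" for p :: "'a mpol"
    by (rule pd_commute)
  have pd_if: "pd l (if b then (1::'a mpol) else 0) = 0" for l b
    by simp
  show "bracket (ham n j i f) (ham n j i g) (X k) = ham n j i (ham n j i f g) (X k)"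
    using k f g *[OF f] *[OF g]
    by (simp add: bracket_def ham_apply h pd_diff pd_mult pd_X pd_if pdc algebra_simps)
qed

lemma divergence_ham:
  assumes "i \<in> {1..n}" "j \<in> {1..n}"
  shows "divergence n (ham n j i f) = 0"
  using assms
  by (simp add: ham_def divergence_add divergence_pmult_partial pd_uminus pd_commute)

section \<open>Lie subalgebras containing the generators\<close>

context
  fixes n :: nat and L :: "('k::field_char_0 mpol \<Rightarrow> 'k mpol) set"
  assumes L: "lie_subalgebra n L"
begin

lemma L_Der: "d \<in> L \<Longrightarrow> d \<in> Der n"
  using L unfolding lie_subalgebra_def by blast

lemma L_zero: "(\<lambda>_. 0) \<in> L"
  using L unfolding lie_subalgebra_def by blast

lemma L_add: "d \<in> L \<Longrightarrow> e \<in> L \<Longrightarrow> (\<lambda>p. d p + e p) \<in> L"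
  using L unfolding lie_subalgebra_def by blast

lemma L_scale: "d \<in> L \<Longrightarrow> Const c \<cdot> d \<in> L"
  using L unfolding lie_subalgebra_def by blast

lemma L_bracket: "d \<in> L \<Longrightarrow> e \<in> L \<Longrightarrow> bracket d e \<in> L"
  using L unfolding lie_subalgebra_def by blast

lemma L_sum: "(\<And>i. i \<in> A \<Longrightarrow> f i \<in> L) \<Longrightarrow> (\<lambda>p. \<Sum>i \<in> A. f i p) \<in> L"
  by (induction A rule: infinite_finite_induct) (simp_all add: L_zero L_add)

lemma L_scale_cancel:
  assumes "Const c \<cdot> d \<in> L" "c \<noteq> 0"
  shows "d \<in> L"
proof -
  have "Const (inverse c) \<cdot> Const c \<cdot> d = d"
    using assms(2) by (simp add: pmult_def fun_eq_iff flip: mult.assoc Const_mult)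
  with L_scale[OF assms(1), of "inverse c"] show ?thesis by simp
qed

text \<open>The working form of \<open>bracket_ham\<close>: nonzero scalars produced by a Poisson
  bracket are divided out.\<close>

lemma ham_poisson:
  assumes "ham n j i f \<in> L" "ham n j i g \<in> L" "f \<in> poly_ring n" "g \<in> poly_ring n"
    and "ham n j i f g = Const c * h" "c \<noteq> 0"
  shows "ham n j i h \<in> L"
  using L_bracket[OF assms(1,2)] L_scale_cancel[OF _ assms(6)]
  by (simp add: bracket_ham assms(3-5) ham_scale)

section \<open>Hamiltonian fields of monomials in two variables\<close>

context
  fixes i j :: nat
  assumes ij: "i \<in> {1..n}" "j \<in> {1..n}" "i \<noteq> j"
begin

lemma poly_ring_monomial: "X j ^ a * X i ^ b \<in> poly_ring n"
  using ij by (intro poly_ring_mult poly_ring_power poly_ring_X)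

text \<open>The bracket produces the factor \<open>a - 2 * b\<close>, which may be negative, hence
  \<open>of_int\<close>. It vanishes exactly when the monomial is a power of
  \<open>X j ^ 2 * X i\<close>.\<close>

lemma ham_monomial_raise:
  assumes "ham n j i (X j ^ 2 * X i ^ 1) \<in> L" "ham n j i (X j ^ a * X i ^ b) \<in> L" "a \<noteq> 2 * b"
  shows "ham n j i (X j ^ Suc a * X i ^ b) \<in> L"
proof (rule ham_poisson[OF assms(1,2) poly_ring_monomial poly_ring_monomial])
  show "ham n j i (X j ^ 2 * X i ^ 1) (X j ^ a * X i ^ b) =
      Const (of_int (int a - 2 * int b)) * (X j ^ Suc a * X i ^ b)"
    using ij unfolding Const_of_int ham_apply[OF poly_ring_monomial]
    by (cases a; cases b; simp add: pd_mult pd_power pd_X del: power_Suc)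
      (simp_all add: algebra_simps power2_eq_square)
  show "of_int (int a - 2 * int b) \<noteq> (0::'k)"
    using assms(3) unfolding of_int_eq_0_iff by linarith
qed

lemma ham_monomial_raise':
  assumes "ham n j i (X j ^ 1 * X i ^ 2) \<in> L" "ham n j i (X j ^ a * X i ^ b) \<in> L" "b \<noteq> 2 * a"
  shows "ham n j i (X j ^ a * X i ^ Suc b) \<in> L"
proof (rule ham_poisson[OF assms(1,2) poly_ring_monomial poly_ring_monomial])
  show "ham n j i (X j ^ 1 * X i ^ 2) (X j ^ a * X i ^ b) =
      Const (of_int (2 * int a - int b)) * (X j ^ a * X i ^ Suc b)"
    using ij unfolding Const_of_int ham_apply[OF poly_ring_monomial]
    by (cases a; cases b; simp add: pd_mult pd_power pd_X del: power_Suc)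
      (simp_all add: algebra_simps power2_eq_square)
  show "of_int (2 * int a - int b) \<noteq> (0::'k)"
    using assms(3) unfolding of_int_eq_0_iff by linarith
qed

lemma ham_monomial:
  assumes xi: "ham n j i (X i) \<in> L"
    and xj3: "ham n j i (X j ^ 3) \<in> L" and xi3: "ham n j i (X i ^ 3) \<in> L"
  shows "ham n j i (X j ^ a * X i ^ b) \<in> L"
proof -
  have P: "X i \<in> poly_ring n" "X j \<in> poly_ring n" "X i ^ k \<in> poly_ring n" "X j ^ k \<in> poly_ring n"
    for k
    using ij by (simp_all add: poly_ring_power)
  have [simp]: "Const 2 = 2" "Const 3 = 3" "Const 6 = 6"
    using Const_of_nat[of 2] Const_of_nat[of 3] Const_of_nat[of 6] by simp_all
  \<comment> \<open>With \<open>x = X j\<close> and \<open>y = X i\<close>, the brackets are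
    \<open>{y, x^3} = 3 x^2\<close>, \<open>{y, x^2} = 2 x\<close>,
    \<open>{x, y^3} = -3 y^2\<close>, \<open>{x^3, y^2} = -6 x^2 y\<close> and
    \<open>{y^3, x^2} = 6 x y^2\<close>. The last two give the raising operators.\<close>
  have xj2: "ham n j i (X j ^ 2) \<in> L"
    by (rule ham_poisson[OF xi xj3, of 3]) (use ij in \<open>simp_all add: ham_apply P pd_power pd_X\<close>)
  have xj: "ham n j i (X j) \<in> L"
    by (rule ham_poisson[OF xi xj2, of 2]) (use ij in \<open>simp_all add: ham_apply P pd_power pd_X\<close>)
  have xi2: "ham n j i (X i ^ 2) \<in> L"
    by (rule ham_poisson[OF xj xi3, of "- 3"])
      (use ij in \<open>simp_all add: ham_apply P pd_power pd_X Const_minus\<close>)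
  have xxy: "ham n j i (X j ^ 2 * X i ^ 1) \<in> L"
    by (rule ham_poisson[OF xj3 xi2, of "- 6"])
      (use ij in \<open>simp_all add: ham_apply P pd_power pd_X Const_minus\<close>)
  have xyy: "ham n j i (X j ^ 1 * X i ^ 2) \<in> L"
    by (rule ham_poisson[OF xi3 xj2, of "6"])
      (use ij in \<open>simp_all add: ham_apply P pd_power pd_X Const_minus\<close>)
  show ?thesis
  proof (induction "a + b" arbitrary: a b)
    case 0
    have "ham n j i (1 :: 'k mpol) = (\<lambda>_. 0)"
      by (simp add: ham_def pmult_def)
    with 0 show ?case by (simp add: L_zero)
  next
    case (Suc k)
    \<comment> \<open>Raising the exponent of \<open>X j\<close> and raising that of \<open>X i\<close> cannot both be unavailable:
      \<open>a = 2 * b + 1\<close> and \<open>b = 2 * a + 1\<close> exclude each other.\<close>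
    have "a = 1 \<and> b = 0 \<or> a = 0 \<and> b = 1 \<or> (0 < a \<and> a - 1 \<noteq> 2 * b) \<or> (0 < b \<and> b - 1 \<noteq> 2 * a)"
      using Suc.hyps(2) by (cases a; cases b) auto
    then consider "a = 1" "b = 0" | "a = 0" "b = 1"
      | a' where "a = Suc a'" "a' \<noteq> 2 * b" | b' where "b = Suc b'" "b' \<noteq> 2 * a"
      by (metis Suc_pred')
    then show ?case
    proof cases
      case 1
      then show ?thesis using xj by simp
    next
      case 2
      then show ?thesis using xi by simp
    next
      case 3
      show ?thesis
        unfolding 3(1) by (rule ham_monomial_raise[OF xxy]) (use Suc 3 in auto)
    next
      case 4
      show ?thesis
        unfolding 4(1) by (rule ham_monomial_raise'[OF xyy]) (use Suc 4 in auto)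
    qed
  qed
qed

text \<open>As \<open>z\<close> is free of both variables, \<open>z \<cdot> partial n j\<close> is
  the field of \<open>X i * z\<close>. Its bracket differentiates in \<open>X j\<close> alone and
  multiplies by \<open>z\<close>, so starting from the exponent \<open>Suc a\<close> gives the
  nonzero factor \<open>Suc a\<close>.\<close>

lemma ham_monomial_mult:
  assumes mono: "\<And>a b. ham n j i (X j ^ a * X i ^ b) \<in> L"
    and z: "z \<in> poly_ring n" "pd i z = 0" "pd j z = 0" "z \<cdot> partial n j \<in> L"
  shows "ham n j i (X j ^ a * X i ^ b * z) \<in> L"
proof (rule ham_poisson[OF _ mono, of "X i * z"])
  show "ham n j i (X i * z) \<in> L"
    using z ij by (simp add: ham_eq_pmult_partial pd_mult pd_X)
  show "X i * z \<in> poly_ring n"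
    using ij z by (simp add: poly_ring_mult)
  show "X j ^ Suc a * X i ^ b \<in> poly_ring n"
    by (rule poly_ring_monomial)
  show "ham n j i (X i * z) (X j ^ Suc a * X i ^ b) =
      Const (of_nat (Suc a)) * (X j ^ a * X i ^ b * z)"
    using ij z unfolding Const_of_nat ham_apply[OF poly_ring_monomial]
    by (simp add: pd_mult pd_power pd_X del: power_Suc)
  show "of_nat (Suc a) \<noteq> (0::'k)"
    by (simp del: of_nat_Suc)
qed

end

section \<open>From two variables to all variables\<close>

lemma pmult_partial_single:
  assumes partial: "partial n 1 \<in> L" and n: "1 \<le> n"
    and mono: "\<And>i a b. i \<in> {2..n} \<Longrightarrow> ham n 1 i (X 1 ^ a * X i ^ b) \<in> L"
    and "Poly_Mapping.keys m \<subseteq> {2..n}"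
  shows "Poly_Mapping.single m 1 \<cdot> partial n 1 \<in> L"
  using assms(4)
\<comment> \<open>The exponent vector is itself a finitely supported map, so the induction adjoins
  one new variable \<open>X i\<close> with its exponent \<open>k\<close> at a time.\<close>
proof (induction m rule: mpol_induct)
  case zero
  then show ?case using partial by (simp add: pmult_def)
next
  case (add i k m)
  have keys: "Poly_Mapping.keys (Poly_Mapping.single i k + m) = insert i (Poly_Mapping.keys m)"
    using add(1,2) by (auto simp: in_keys_iff lookup_add lookup_single when_def split: if_splits)
  with add.prems have i: "i \<in> {2..n}" and m: "Poly_Mapping.keys m \<subseteq> {2..n}"
    by simp_all
  define z :: "'k mpol" where "z = Poly_Mapping.single m 1"
  have z: "z \<in> poly_ring n" "pd i z = 0" "pd 1 z = 0"
    using m add(2) by (auto simp: z_def in_keys_iff intro!: poly_ring_single pd_single_eq_zero)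
  \<comment> \<open>The exponent is \<open>Suc k\<close> because forming the field differentiates
    once in \<open>X i\<close>.\<close>
  have "ham n 1 i (X 1 ^ 0 * X i ^ Suc k * z) \<in> L"
    by (rule ham_monomial_mult) (use i z mono add.IH[OF m] in \<open>simp_all add: z_def\<close>)
  moreover have "ham n 1 i (X 1 ^ 0 * X i ^ Suc k * z) =
      Const (of_nat (Suc k)) \<cdot> (X i ^ k * z) \<cdot> partial n 1"
    using i z unfolding Const_of_nat
    by (simp add: ham_eq_pmult_partial pd_mult pd_power pd_X del: power_Suc)
      (simp add: pmult_def algebra_simps)
  ultimately have "(X i ^ k * z) \<cdot> partial n 1 \<in> L"
    by (metis L_scale_cancel of_nat_eq_0_iff nat.distinct(1))
  then show ?case
    by (simp add: z_def X_power mult_single)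
qed

text \<open>By linearity one monomial suffices. It is the product of its part in \<open>X 1\<close>
  and \<open>X i\<close> and a cofactor free of both, to which \<open>ham_monomial_mult\<close>
  applies.\<close>

lemma ham_in_L:
  assumes partial: "partial n 1 \<in> L"
    and mono: "\<And>i a b. i \<in> {2..n} \<Longrightarrow> ham n 1 i (X 1 ^ a * X i ^ b) \<in> L"
    and i: "i \<in> {2..n}" and "f \<in> poly_ring n"
  shows "ham n 1 i f \<in> L"
  using assms(4)
proof (induction f rule: poly_ring_induct)
  case zero
  then show ?case by (simp add: ham_zero L_zero)
next
  case (add m c q)
  define a b where "a = Poly_Mapping.lookup m 1" and "b = Poly_Mapping.lookup m i"
  define m' where "m' = m - Poly_Mapping.single 1 a - Poly_Mapping.single i b"
  have m: "m = Poly_Mapping.single 1 a + Poly_Mapping.single i b + m'"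
    using i by (intro poly_mapping_eqI)
      (auto simp: m'_def a_def b_def lookup_add lookup_minus lookup_single when_def)
  have m'0: "Poly_Mapping.lookup m' 1 = 0" "Poly_Mapping.lookup m' i = 0"
    by (simp_all add: m'_def a_def b_def lookup_minus lookup_single when_def)
  have "Poly_Mapping.keys m' \<subseteq> Poly_Mapping.keys m"
    by (auto simp: m'_def in_keys_iff lookup_minus)
  have m'1: "Poly_Mapping.keys m' \<subseteq> {2..n}"
  proof
    fix k assume k: "k \<in> Poly_Mapping.keys m'"
    then have "k \<in> {1..n}"
      using \<open>Poly_Mapping.keys m' \<subseteq> Poly_Mapping.keys m\<close> add(1) by blast
    moreover have "k \<noteq> 1"
      using k m'0(1) by (auto simp: in_keys_iff)
    ultimately show "k \<in> {2..n}" by simp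
  qed
  have "ham n 1 i (X 1 ^ a * X i ^ b * Poly_Mapping.single m' 1) \<in> L"
  proof (rule ham_monomial_mult)
    show "Poly_Mapping.single m' 1 \<in> poly_ring n"
      using m'1 by (intro poly_ring_single) auto
    show "Poly_Mapping.single m' 1 \<cdot> partial n 1 \<in> L"
      by (rule pmult_partial_single) (use i m'1 partial mono in auto)
  qed (use i mono m'0 in \<open>simp_all add: pd_single\<close>)
  moreover have "Poly_Mapping.single m c =
      Const c * (X 1 ^ a * X i ^ b * Poly_Mapping.single m' (1::'k))"
    by (subst m) (simp add: Const_def X_power mult_single add.assoc)
  ultimately show ?case
    using add.IH by (simp add: ham_add ham_scale L_add L_scale)
qed

lemma pmult_partial_in_L:
  assumes partial: "partial n 1 \<in> L" and n: "1 \<le> n"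
    and mono: "\<And>i a b. i \<in> {2..n} \<Longrightarrow> ham n 1 i (X 1 ^ a * X i ^ b) \<in> L"
    and g: "g \<in> poly_ring n" "pd 1 g = 0"
  shows "g \<cdot> partial n 1 \<in> L"
proof -
  \<comment> \<open>The vanishing derivative means that no monomial of \<open>g\<close> contains
    \<open>X 1\<close>.\<close>
  have "m \<in> Poly_Mapping.keys g \<Longrightarrow> Poly_Mapping.keys m \<subseteq> {2..n}" for m
  proof
    fix k assume m: "m \<in> Poly_Mapping.keys g" and k: "k \<in> Poly_Mapping.keys m"
    then have "k \<in> {1..n}"
      using g(1) unfolding poly_ring_def by blast
    moreover have "k \<noteq> 1"
      using k pd_eq_zeroD[OF g(2) m] by (auto simp: in_keys_iff)
    ultimately show "k \<in> {2..n}" by simp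
  qed
  then show ?thesis
  proof (induction g rule: mpol_induct)
    case zero
    then show ?case by (simp add: pmult_def L_zero)
  next
    case (add m c q)
    have keys: "Poly_Mapping.keys (Poly_Mapping.single m c + q) = insert m (Poly_Mapping.keys q)"
      using add(1,2) by (auto simp: in_keys_iff lookup_add lookup_single when_def split: if_splits)
    have "Poly_Mapping.single m 1 \<cdot> partial n 1 \<in> L"
      by (rule pmult_partial_single[OF partial n mono]) (use add.prems keys in auto)
    then have "(\<lambda>p. (Const c \<cdot> Poly_Mapping.single m 1 \<cdot> partial n 1) p + (q \<cdot> partial n 1) p) \<in> L"
      using add keys by (intro L_add L_scale) auto
    moreover have "Poly_Mapping.single m c = Const c * Poly_Mapping.single m 1"
      by (simp add: Const_def mult_single)
    ultimately show ?case
      by (simp add: pmult_def algebra_simps)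
  qed
qed

lemma div_const_subset_L:
  assumes n: "1 \<le> n" and partial: "partial n 1 \<in> L" and H: "X 1 \<cdot> partial n 1 \<in> L"
    and sq1: "\<And>i. i \<in> {2..n} \<Longrightarrow> X i ^ 2 \<cdot> partial n 1 \<in> L"
    and sq2: "\<And>i. i \<in> {2..n} \<Longrightarrow> X 1 ^ 2 \<cdot> partial n i \<in> L"
  shows "div_const n \<subseteq> L"
proof
  \<comment> \<open>Up to nonzero scalars, \<open>partial n 1\<close> and the two square generators
    for \<open>i\<close> are the fields of \<open>X i\<close>, \<open>X i ^ 3\<close> and
    \<open>X 1 ^ 3\<close>.\<close>
  have mono: "ham n 1 i (X 1 ^ a * X i ^ b) \<in> L" if i: "i \<in> {2..n}" for i a b
  proof (rule ham_monomial)
    show "ham n 1 i (X i) \<in> L"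
      using i partial by (simp add: ham_eq_pmult_partial pd_X pmult_def)
    have "ham n 1 i (X i ^ 3 :: 'k mpol) = Const 3 \<cdot> X i ^ 2 \<cdot> partial n 1"
      using i Const_of_nat[of 3, where 'a = 'k]
      by (simp add: ham_eq_pmult_partial pd_X pd_power pmult_def mult.assoc)
    then show "ham n 1 i (X i ^ 3) \<in> L"
      using L_scale sq1[OF i] by simp
    have "ham n 1 i (X 1 ^ 3 :: 'k mpol) = Const (- 3) \<cdot> X 1 ^ 2 \<cdot> partial n i"
      using i Const_of_nat[of 3, where 'a = 'k]
      by (simp add: ham_eq_pmult_partial' pd_X pd_power pmult_def mult.assoc Const_minus)
    then show "ham n 1 i (X 1 ^ 3) \<in> L"
      using L_scale sq2[OF i] by simp
  qed (use i in auto)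
  note ham = ham_in_L[OF partial mono]
  fix d :: "'k mpol \<Rightarrow> 'k mpol"
  assume "d \<in> div_const n"
  then obtain c where d: "d \<in> Der n" and c: "divergence n d = Const c"
    by (auto simp: div_const_def)
  have "\<forall>i \<in> {2..n}. \<exists>f \<in> poly_ring n. pd 1 f = d (X i)"
    using n by (intro ballI pd_antiderivative Der_closed[OF d] poly_ring_X) auto
  then obtain f where f: "f i \<in> poly_ring n" "pd 1 (f i) = d (X i)" if "i \<in> {2..n}" for i
    by metis
  \<comment> \<open>Each summand contributes \<open>- d (X i)\<close> at \<open>X i\<close> and
    nothing at the other \<open>X j\<close> with \<open>j\<close> at least 2, so
    \<open>d + h\<close> has only a component at \<open>partial n 1\<close>.\<close>
  define h where "h = (\<lambda>p. \<Sum>i \<in> {2..n}. ham n 1 i (f i) p)"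
  have h: "h \<in> L"
    unfolding h_def by (intro L_sum ham f)
  \<comment> \<open>The term \<open>Const c * X 1\<close> carries the whole divergence of
    \<open>d\<close>; comparing divergences below shows that the remainder \<open>g\<close> is free
    of \<open>X 1\<close>.\<close>
  define g where "g = d (X 1) + h (X 1) - Const c * X 1"
  have g: "g \<in> poly_ring n"
    unfolding g_def
    using n by (intro poly_ring_diff poly_ring_add poly_ring_mult Der_closed[OF d]
        Der_closed[OF L_Der[OF h]]) simp_all
  have hX: "h (X j) = - d (X j)" if j: "j \<in> {2..n}" for j
  proof -
    have "h (X j) = (\<Sum>i \<in> {2..n}. if i = j then - d (X j) else 0)"
      unfolding h_def
      by (intro sum.cong refl) (use j f in \<open>auto simp: ham_apply pd_X\<close>)
    then show ?thesis using j by simp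
  qed
  have dh: "(\<lambda>p. d p + h p) = (\<lambda>p. (g \<cdot> partial n 1) p + (Const c \<cdot> X 1 \<cdot> partial n 1) p)"
  proof (rule Der_eqI)
    show "(\<lambda>p. d p + h p) \<in> Der n"
      by (intro Der_add d L_Der h)
    show "(\<lambda>p. (g \<cdot> partial n 1) p + (Const c \<cdot> X 1 \<cdot> partial n 1) p) \<in> Der n"
      using n g by (intro Der_add Der_pmult partial_in_Der) simp_all
    fix j assume j: "j \<in> {1..n}"
    then show "d (X j) + h (X j) = (g \<cdot> partial n 1) (X j) + (Const c \<cdot> X 1 \<cdot> partial n 1) (X j)"
    proof (cases "j = 1")
      case True
      with n show ?thesis by (simp add: pmult_def partial_def pd_X g_def)
    next
      case False
      with j have "j \<in> {2..n}" by auto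
      with False show ?thesis by (simp add: hX pmult_def partial_def pd_X)
    qed
  qed
  have "divergence n h = 0"
  proof -
    have "divergence n h = (\<Sum>i \<in> {2..n}. divergence n (ham n 1 i (f i)))"
      unfolding h_def divergence_def pd_sum by (rule sum.swap)
    then show ?thesis using n by (simp add: divergence_ham)
  qed
  then have "Const c = divergence n (\<lambda>p. d p + h p)"
    by (simp add: divergence_add c)
  also have "\<dots> = pd 1 g + Const c"
    unfolding dh using n
    by (simp add: divergence_add divergence_scale divergence_pmult_partial pd_X)
  finally have "pd 1 g = 0" by simp
  with g have "g \<cdot> partial n 1 \<in> L"
    by (intro pmult_partial_in_L partial n mono)
  then have "(\<lambda>p. d p + h p) \<in> L"
    unfolding dh by (intro L_add L_scale H)
  then have "(\<lambda>p. (d p + h p) + (Const (- 1) \<cdot> h) p) \<in> L"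
    by (rule L_add[OF _ L_scale[OF h]])
  then show "d \<in> L"
    by (simp add: pmult_def Const_minus)
qed

end

section \<open>Minimality\<close>

lemma lookup_X_mult_zero: "Poly_Mapping.lookup (X i * p) 0 = 0"
proof (induction p rule: mpol_induct)
  case (add m c q)
  have "Poly_Mapping.lookup (Poly_Mapping.single i 1 + m) i \<noteq> 0"
    by (simp add: lookup_add)
  then have "Poly_Mapping.single i 1 + m \<noteq> 0"
    by (metis lookup_zero)
  with add show ?case
    by (simp add: distrib_left lookup_add X_def mult_single lookup_single when_def)
qed simp

text \<open>A second differentiation would give \<open>2 = 0\<close>, contrary to characteristic
  zero.\<close>

lemma pd_X_square_neq_zero: "pd i (X i ^ 2) \<noteq> (0 :: 'k::field_char_0 mpol)"
proof
  assume *: "pd i (X i ^ 2) = (0 :: 'k mpol)"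
  have "pd i (X i ^ 2) = Const 2 * (X i :: 'k mpol)"
    using Const_of_nat[of 2, where 'a = 'k] by (simp add: pd_power pd_X)
  with * have "pd i (Const 2 * (X i :: 'k mpol)) = pd i 0"
    by metis
  then show False
    by (simp add: pd_Const_mult pd_X)
qed

theorem theorem1p4:
  fixes n :: nat
  assumes "n \<ge> 2"
  shows "minimal_generating_set n
    (div_const n :: ('k::field_char_0 mpol \<Rightarrow> 'k mpol) set)
    ({partial n 1} \<union>
     {X i ^ 2 \<cdot> partial n 1 | i. i \<in> {2..n}} \<union>
     {X 1 ^ 2 \<cdot> partial n i | i. i \<in> {2..n}} \<union>
     {X 1 \<cdot> partial n 1})"
    (is "minimal_generating_set n ?D ?S")
proof -
  have X1: "(X 1 :: 'k mpol) \<in> poly_ring n" using assms by simp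
  have Xi: "(X i :: 'k mpol) \<in> poly_ring n" if "i \<in> {2..n}" for i using that by simp
  have Der: "s \<in> Der n" if "s \<in> ?S" for s
    using that X1 Xi by (auto intro!: Der_pmult partial_in_Der poly_ring_power)
  have div1: "divergence n (partial n 1 :: 'k mpol \<Rightarrow> _) = 0"
    using divergence_pmult_partial[of 1 n "1 :: 'k mpol"] assms by (simp add: pmult_def)
  have div0: "divergence n s = 0" if "s \<in> ?S" "s \<noteq> X 1 \<cdot> partial n 1" for s
    using that assms div1 by (auto simp: divergence_pmult_partial pd_power pd_X)
  have divH: "divergence n (X 1 \<cdot> partial n 1) = (1 :: 'k mpol)"
    using assms by (simp add: divergence_pmult_partial pd_X)
  have S: "?S \<subseteq> ?D"
  proof
    fix s assume s: "s \<in> ?S"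
    have "divergence n s \<in> range Const"
      using div0[OF s] divH by (metis Const_one Const_zero rangeI)
    with Der[OF s] show "s \<in> ?D" by (simp add: div_const_def)
  qed
  have gen: "lie_generated n ?S = ?D"
  proof
    show "lie_generated n ?S \<subseteq> ?D"
      by (rule lie_generated_subset[OF lie_subalgebra_div_const S])
    have "?D \<subseteq> L" if "lie_subalgebra n L" "?S \<subseteq> L" for L
      by (rule div_const_subset_L[OF that(1)]) (use assms that(2) in auto)
    then show "?D \<subseteq> lie_generated n ?S"
      unfolding lie_generated_def by blast
  qed
  have app: "(a \<cdot> partial n j) p = a * pd j p" "partial n j p = pd j p"
    if "p \<in> poly_ring n" for a p :: "'k mpol" and j
    using that by (simp_all add: pmult_def partial_def)
  \<comment> \<open>A proper subset of the generators misses some \<open>s\<close>, so it generates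
    an algebra inside the corresponding \<open>M\<close>, which does not contain
    \<open>s\<close>.\<close>
  have separate: "\<exists>M. lie_subalgebra n M \<and> ?S - {s} \<subseteq> M \<and> s \<notin> M" if s: "s \<in> ?S" for s
  proof -
    consider "s = partial n 1" | i where "i \<in> {2..n}" "s = X i ^ 2 \<cdot> partial n 1"
      | i where "i \<in> {2..n}" "s = X 1 ^ 2 \<cdot> partial n i" | "s = X 1 \<cdot> partial n 1"
      using s by blast
    then show ?thesis
    proof cases
      case 1
      \<comment> \<open>The maximal ideal of the origin. The coefficients of all other generators
        vanish there, whereas \<open>partial n 1\<close> sends \<open>X 1\<close> to 1.\<close>
      define V :: "'k mpol set" where "V = {p \<in> poly_ring n. Poly_Mapping.lookup p 0 = 0}"
      have "lie_subalgebra n {d \<in> Der n. d ` V \<subseteq> V}"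
        by (rule lie_subalgebra_stabilizer)
          (auto simp: V_def lookup_add lookup_Const_mult poly_ring_add poly_ring_mult)
      moreover have "t p \<in> V" if t: "t \<in> ?S - {s}" and p: "p \<in> V" for t p
      proof -
        have "t p \<in> poly_ring n"
          using t p Der_closed[OF Der, of t p] by (auto simp: V_def)
        moreover have "Poly_Mapping.lookup (t p) 0 = 0"
          using t p 1 by (auto simp: V_def app power2_eq_square mult.assoc lookup_X_mult_zero)
        ultimately show ?thesis by (simp add: V_def)
      qed
      moreover have "X 1 \<in> V" "s (X 1) \<notin> V"
        using X1 lookup_X_mult_zero[of 1 "1 :: 'k mpol"] by (simp_all add: V_def 1 app pd_X)
      ultimately show ?thesis
        using Der by (intro exI[of _ "{d \<in> Der n. d ` V \<subseteq> V}"]) blast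
    next
      case (2 i)
      \<comment> \<open>The other generators have coefficients free of \<open>X i\<close> or are
        multiples of \<open>partial n i\<close>, which kills \<open>V\<close>; but \<open>s\<close>
        sends \<open>X 1\<close> to \<open>X i ^ 2\<close>.\<close>
      define V :: "'k mpol set" where "V = {p \<in> poly_ring n. pd i p = 0}"
      have "lie_subalgebra n {d \<in> Der n. d ` V \<subseteq> V}"
        by (rule lie_subalgebra_stabilizer)
          (auto simp: V_def pd_add pd_Const_mult poly_ring_add poly_ring_mult)
      moreover have "t p \<in> V" if t: "t \<in> ?S - {s}" and p: "p \<in> V" for t p
      proof -
        have "t p \<in> poly_ring n"
          using t p Der_closed[OF Der, of t p] by (auto simp: V_def)
        moreover have "pd i (pd j p) = 0" for j
          using p by (subst pd_commute) (simp add: V_def)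
        then have "pd i (t p) = 0"
          using t p 2 by (auto simp: V_def app pd_mult pd_power pd_X)
        ultimately show ?thesis by (simp add: V_def)
      qed
      moreover have "X 1 \<in> V" "s (X 1) \<notin> V"
        using X1 2 pd_X_square_neq_zero[of i, where 'k = 'k] by (auto simp: V_def app pd_X)
      ultimately show ?thesis
        using Der by (intro exI[of _ "{d \<in> Der n. d ` V \<subseteq> V}"]) blast
    next
      case (3 i)
      \<comment> \<open>All other generators kill \<open>X i\<close>, whereas \<open>s\<close> sends
        it to \<open>X 1 ^ 2\<close>, which is no scalar multiple of \<open>X i\<close>, as
        \<open>pd 1\<close> shows.\<close>
      define V :: "'k mpol set" where "V = range (\<lambda>c. Const c * X i)"
      have "lie_subalgebra n {d \<in> Der n. d ` V \<subseteq> V}"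
      proof (rule lie_subalgebra_stabilizer)
        show "V \<subseteq> poly_ring n"
          using 3 by (auto simp: V_def poly_ring_mult)
        show "0 \<in> V"
          unfolding V_def by (rule range_eqI[of _ _ 0]) simp
      qed (auto simp: V_def simp flip: distrib_right mult.assoc Const_add Const_mult)
      moreover have "t p \<in> V" if t: "t \<in> ?S - {s}" and p: "p \<in> V" for t p
      proof -
        have "t (X i) = 0"
          using t 3 by (auto simp: app pd_X)
        then have "t p = 0"
          using p t 3 Der_scale[OF Der, of t "X i"] by (auto simp: V_def)
        then show ?thesis
          unfolding V_def by (intro range_eqI[of _ _ 0]) simp
      qed
      moreover have "X i \<in> V"
        unfolding V_def by (rule range_eqI[of _ _ 1]) simp
      moreover have "s (X i) \<notin> V"
      proof
        assume "s (X i) \<in> V"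
        then obtain c where "X 1 ^ 2 = Const c * (X i :: 'k mpol)"
          using 3 by (auto simp: V_def app pd_X)
        then have "pd 1 (X 1 ^ 2) = pd 1 (Const c * (X i :: 'k mpol))"
          by simp
        also have "\<dots> = 0"
          using 3 by (simp add: pd_Const_mult pd_X)
        finally show False
          using pd_X_square_neq_zero by blast
      qed
      ultimately show ?thesis
        using Der by (intro exI[of _ "{d \<in> Der n. d ` V \<subseteq> V}"]) blast
    next
      case 4
      have "lie_subalgebra n {d \<in> Der n. divergence n d \<in> {0 :: 'k mpol}}"
        by (rule lie_subalgebra_divergence) (auto intro: range_eqI[of _ _ 0])
      then show ?thesis
        using Der div0 4 divH
        by (intro exI[of _ "{d \<in> Der n. divergence n d \<in> {0 :: 'k mpol}}"]) auto
    qed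
  qed
  show ?thesis
    unfolding minimal_generating_set_def
  proof (intro conjI allI impI)
    fix T assume "T \<subset> ?S"
    then obtain s where T: "T \<subseteq> ?S" and s: "s \<in> ?S" "s \<notin> T" by blast
    obtain M where M: "lie_subalgebra n M" "?S - {s} \<subseteq> M" "s \<notin> M"
      using separate[OF s(1)] by blast
    have "lie_generated n T \<subseteq> M"
      by (rule lie_generated_subset[OF M(1)]) (use T s(2) M(2) in blast)
    moreover have "s \<in> ?D"
      using S s(1) by (rule subsetD)
    ultimately show "lie_generated n T \<noteq> ?D"
      using M(3) by blast
  qed (fact S gen)+
qed

end
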